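(* For each positive integer $n$, let $f(n)$ be the smallest integer such that for every positive integer $m$ with $2m\ge f(n)$, and every pair of sets $A,B\subseteq[n]=\{1,\dots,n\}$ each consisting of $2m$ consecutive integers, there is a coprime mapping from $A$ to $B$. Then $f(n)=\exp(O((\log\log n)^2))$, i.e. there is a constant $C$ such that $f(n)\le \exp(C(\log\log n)^2)$ for all sufficiently large $n$.
   Context: For sets of integers $A,B$, a bijection $g:A\to B$ is a coprime mapping if $a$ and $g(a)$ are coprime for every $a\in A$. *)

theory Defs
  imports Complex_Main
begin

definition coprime_mapping :: "(int \<Rightarrow> int) \<Rightarrow> int set \<Rightarrow> int set \<Rightarrow> bool" where
  "coprime_mapping g A B \<longleftrightarrow> bij_betw g A B \<and> (\<forall>a\<in>A. coprime a (g a))"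

definition consecutive_ints :: "nat \<Rightarrow> int set \<Rightarrow> bool" where
  "consecutive_ints k A \<longleftrightarrow> (\<exists>a. A = {a..<a + int k})"

definition coprime_threshold :: "nat \<Rightarrow> nat \<Rightarrow> bool" where
  "coprime_threshold n k \<longleftrightarrow>
     (\<forall>m\<ge>1. k \<le> 2 * m \<longrightarrow>
       (\<forall>A B. A \<subseteq> {1..int n} \<longrightarrow> B \<subseteq> {1..int n} \<longrightarrow>
          consecutive_ints (2 * m) A \<longrightarrow> consecutive_ints (2 * m) B \<longrightarrow>
          (\<exists>g. coprime_mapping g A B)))"

text \<open>The minimum is taken over the nonnegative integers. For n at least 6 this agrees with
  the minimum over all integers, since there is no coprime mapping from {3,4} to {5,6}
  (both elements of the source would have to go to 5).
  For n at most 5 every integer is a threshold, so that the minimum over all integers does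
  not exist; the value here is then 0.\<close>

definition min_threshold :: "nat \<Rightarrow> nat" where
  "min_threshold n = (LEAST k. coprime_threshold n k)"

lemma coprime_threshold_min_threshold: "coprime_threshold n (min_threshold n)"
proof -
  have "coprime_threshold n (Suc n)"
    unfolding coprime_threshold_def
  proof (intro allI impI)
    fix m A B
    assume m: "1 \<le> m" "Suc n \<le> 2 * m" and A: "A \<subseteq> {1..int n}" "consecutive_ints (2 * m) A"
    from A(2) have "card A = 2 * m" by (auto simp: consecutive_ints_def)
    moreover have "card A \<le> n" using card_mono[OF _ A(1)] by simp
    ultimately show "\<exists>g. coprime_mapping g A B" using m by simp
  qed
  then show ?thesis unfolding min_threshold_def by (rule LeastI)
qed

end

theory Submission
  imports Defs "HOL-Number_Theory.Cong" "HOL-Real_Asymp.Real_Asymp"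
begin

text \<open>
  The even elements of A are matched with the odd elements of B, and the odd elements of A with
  the even elements of B. This is a matching problem between two progressions of m terms and
  step 2, in which only odd primes can be common divisors. If Hall's condition fails, then up to
  symmetry there are T and S without a coprime pair, one in each progression, such that
  \<open>q = m - card S\<close> satisfies \<open>q < card T\<close> and \<open>q \<le> m / 2\<close>.

  A number t up to n has at most K = O(log n) prime divisors, and the i-th odd one is at least
  \<open>i + 1\<close>, so that the product F(t) of \<open>p / (p - 1)\<close> over these odd primes is at most \<open>K + 1\<close>.
  Inclusion-exclusion truncated at depth r = O(log K) gives about \<open>m / F(t)\<close> terms coprime
  to t, as soon as m exceeds a power of K with exponent O(r), which is
  \<open>exp (O((log log n)^2))\<close>. For t in T these terms lie outside S, hence F(t) is at least
  nearly \<open>m / q\<close>. But the third moment of F over a progression of m terms is below 3.3 m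
  (primes above 100 K hardly matter, and the smaller ones are treated by expanding the product),
  so that this happens for at most about \<open>3.3 m (q / m)^3 < q\<close> values of t.
\<close>


section \<open>Hall's marriage theorem\<close>

text \<open>Induction on the index set. If a nonempty proper subset J is tight (as many neighbours
  as members), J is matched among its neighbours and the rest among the remaining elements. If none
  is tight, one index may take any neighbour y: the strict inequality for the other subsets absorbs
  the loss of y.\<close>

lemma hall:
  fixes N :: "'a \<Rightarrow> 'b set"
  assumes "finite I" and "\<And>i. i \<in> I \<Longrightarrow> finite (N i)"
    and "\<And>J. J \<subseteq> I \<Longrightarrow> card J \<le> card (\<Union>(N ` J))"
  shows "\<exists>f. inj_on f I \<and> (\<forall>i\<in>I. f i \<in> N i)"
  using assms
proof (induction I arbitrary: N rule: finite_psubset_induct)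
  case (psubset I)
  note fin = psubset.prems(1) and hall = psubset.prems(2)
  have finU: "finite (\<Union>(N ` J))" if "J \<subseteq> I" for J
    using that fin \<open>finite I\<close> by (auto dest: finite_subset)
  show ?case
  proof (cases "\<exists>J. J \<noteq> {} \<and> J \<subset> I \<and> card J = card (\<Union>(N ` J))")
    case True
    then obtain J where J: "J \<noteq> {}" "J \<subset> I" "card J = card (\<Union>(N ` J))" by blast
    have finJ: "finite J" using J(2) \<open>finite I\<close> by (meson finite_subset psubset_imp_subset)
    have "\<exists>f. inj_on f J \<and> (\<forall>i\<in>J. f i \<in> N i)"
      by (rule psubset.IH[OF J(2)]) (use J(2) fin hall in blast)+
    then obtain f where f: "inj_on f J" "\<forall>i\<in>J. f i \<in> N i" by blast
    define N' where "N' i = N i - \<Union>(N ` J)" for i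
    have "\<exists>g. inj_on g (I - J) \<and> (\<forall>i\<in>I - J. g i \<in> N' i)"
    proof (rule psubset.IH)
      show "I - J \<subset> I" using J by blast
      show "finite (N' i)" if "i \<in> I - J" for i using fin that unfolding N'_def by blast
      fix L assume L: "L \<subseteq> I - J"
      have finL: "finite L" using L \<open>finite I\<close> by (meson finite_Diff finite_subset)
      have "\<Union>(N' ` L) = \<Union>(N ` (L \<union> J)) - \<Union>(N ` J)" unfolding N'_def by blast
      then have "card (\<Union>(N' ` L)) = card (\<Union>(N ` (L \<union> J))) - card (\<Union>(N ` J))"
        using finU[of J] J(2) by (simp add: card_Diff_subset)
      \<comment> \<open>Hall's condition for L \<union> J, less the equality for J, is Hall's
        condition for L with the neighbours of J removed.\<close>
      moreover have "card (L \<union> J) \<le> card (\<Union>(N ` (L \<union> J)))"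
        by (rule hall) (use L J in blast)
      moreover have "card (L \<union> J) = card L + card J"
        using L finL finJ by (intro card_Un_disjoint) blast+
      ultimately show "card L \<le> card (\<Union>(N' ` L))" using J(3) by linarith
    qed
    then obtain g where g: "inj_on g (I - J)" "\<forall>i\<in>I - J. g i \<in> N' i" by blast
    define h where "h i = (if i \<in> J then f i else g i)" for i
    have "inj_on h I"
    proof (rule inj_onI)
      fix i j assume ij: "i \<in> I" "j \<in> I" "h i = h j"
      have sep: "f i \<noteq> g j" if "i \<in> J" "j \<in> I - J" for i j
      proof -
        have "f i \<in> \<Union>(N ` J)" using f(2) that(1) by blast
        moreover have "g j \<notin> \<Union>(N ` J)" using g(2) that(2) unfolding N'_def by simp
        ultimately show ?thesis by metis
      qed
      consider "i \<in> J" "j \<in> J" | "i \<in> J" "j \<in> I - J" | "i \<in> I - J" "j \<in> J"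
        | "i \<in> I - J" "j \<in> I - J"
        using ij by blast
      then show "i = j"
      proof cases
        case 1
        then show ?thesis using ij(3) f(1) by (simp add: h_def inj_on_eq_iff)
      next
        case 2
        then show ?thesis using ij(3) sep[of i j] by (simp add: h_def)
      next
        case 3
        then show ?thesis using ij(3) sep[of j i] by (simp add: h_def)
      next
        case 4
        then show ?thesis using ij(3) g(1) by (simp add: h_def inj_on_eq_iff)
      qed
    qed
    moreover have "\<forall>i\<in>I. h i \<in> N i"
      using f(2) g(2) unfolding h_def N'_def by auto
    ultimately show ?thesis by blast
  next
    case False
    have slack: "card J < card (\<Union>(N ` J))" if "J \<noteq> {}" "J \<subset> I" for J
      using False hall[of J] that by (metis le_neq_implies_less psubset_imp_subset)
    show ?thesis
    proof (cases "I = {}")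
      case True
      then show ?thesis by simp
    next
      case False
      then obtain i where i: "i \<in> I" by blast
      have "N i \<noteq> {}" using hall[of "{i}"] i by auto
      then obtain y where y: "y \<in> N i" by blast
      have "\<exists>g. inj_on g (I - {i}) \<and> (\<forall>j\<in>I - {i}. g j \<in> N j - {y})"
      proof (rule psubset.IH)
        show "I - {i} \<subset> I" using i by blast
        show "finite (N j - {y})" if "j \<in> I - {i}" for j using fin that by blast
        fix L assume L: "L \<subseteq> I - {i}"
        show "card L \<le> card (\<Union>j\<in>L. N j - {y})"
        proof (cases "L = {}")
          case False
          have "card L < card (\<Union>(N ` L))" by (rule slack) (use False L i in blast)+
          moreover have "(\<Union>j\<in>L. N j - {y}) = \<Union>(N ` L) - {y}" by blast
          moreover have "card (\<Union>(N ` L)) - 1 \<le> card (\<Union>(N ` L) - {y})"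
            using diff_card_le_card_Diff[of "{y}" "\<Union>(N ` L)"] by simp
          ultimately show ?thesis by simp
        qed simp
      qed
      then obtain g where g: "inj_on g (I - {i})" "\<forall>j\<in>I - {i}. g j \<in> N j - {y}" by blast
      have "inj_on (g(i := y)) I"
      proof (rule inj_onI)
        fix j k assume jk: "j \<in> I" "k \<in> I" "(g(i := y)) j = (g(i := y)) k"
        have "g l \<noteq> y" if "l \<in> I - {i}" for l using g(2) that by blast
        then show "j = k" using jk g(1)
          by (cases "j = i"; cases "k = i") (simp_all add: inj_on_eq_iff, metis+)
      qed
      moreover have "\<forall>j\<in>I. (g(i := y)) j \<in> N j" using g(2) y by auto
      ultimately show ?thesis by blast
    qed
  qed
qed

section \<open>Sieving an arithmetic progression\<close>

text \<open>As 2 is invertible modulo the odd number d, the divisibility fixes i modulo d, and a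
  window of d consecutive indices contains each residue once.\<close>

lemma ex1_dvd_in_block:
  fixes d m :: nat and x :: int
  assumes "odd d"
  shows "\<exists>!i. i \<in> {m..<m + d} \<and> int d dvd x + 2 * int i"
proof -
  have cop: "coprime (int d) 2" using assms by simp
  have d: "d > 0" using assms by (cases d) auto
  obtain c where c: "[2 * c = - x] (mod int d)"
    using cong_solve_coprime_int[of 2 "int d"] cop
    by (metis cong_scalar_right coprime_commute mult.assoc mult.right_neutral mult.commute)
  \<comment> \<open>The representative of c modulo d in the window that starts at m.\<close>
  define i where "i = m + nat ((c - int m) mod int d)"
  have "int i = int m + (c - int m) mod int d" using d by (simp add: i_def)
  then have "int i mod int d = (int m + (c - int m)) mod int d" by (simp only: mod_add_right_eq)
  then have "[int i = c] (mod int d)"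
    by (simp add: unique_euclidean_semiring_class.cong_def)
  then have "[x + 2 * int i = x + 2 * c] (mod int d)" by (intro cong_add cong_mult) auto
  also have "[x + 2 * c = x + - x] (mod int d)" using c by (intro cong_add) auto
  finally have "int d dvd x + 2 * int i" by (simp add: cong_0_iff)
  moreover have "i \<in> {m..<m + d}" using d by (simp add: i_def nat_less_iff)
  moreover have "i = j" if "i \<in> {m..<m + d} \<and> int d dvd x + 2 * int i"
    "j \<in> {m..<m + d} \<and> int d dvd x + 2 * int j" for i j
  proof -
    have "int d dvd (x + 2 * int i) - (x + 2 * int j)" using that by (intro dvd_diff) auto
    then have "int d dvd 2 * (int i - int j)" by (simp add: algebra_simps)
    then have "int d dvd int i - int j" using cop using coprime_dvd_mult_right_iff by blast
    moreover have "\<bar>int i - int j\<bar> < int d" using that by auto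
    ultimately show "i = j" using dvd_imp_le_int[of "int i - int j" "int d"] by fastforce
  qed
  ultimately show ?thesis by blast
qed

text \<open>Cutting off the last d indices removes exactly one solution and lowers m / d by 1, so
  the error is unchanged. With fewer than d indices left, both the count and m / d lie between 0 and
  1.\<close>

lemma card_dvd_progression:
  fixes d m :: nat and x :: int
  assumes "odd d"
  shows "\<bar>real (card {i. i < m \<and> int d dvd x + 2 * int i}) - real m / real d\<bar> \<le> 1"
proof (induction m rule: less_induct)
  case (less m)
  have d: "d > 0" using assms by (cases d) auto
  show ?case
  proof (cases "m < d")
    case True
    obtain u where u: "\<And>i. i \<in> {0..<0 + d} \<and> int d dvd x + 2 * int i \<Longrightarrow> i = u"
      using ex1_dvd_in_block[OF assms, of 0 x] by blast
    have "{i. i < m \<and> int d dvd x + 2 * int i} \<subseteq> {u}" using u True by auto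
    then have "card {i. i < m \<and> int d dvd x + 2 * int i} \<le> 1"
      using card_mono[of "{u}"] by fastforce
    moreover have "real m / real d \<le> 1" using True by simp
    moreover have "0 \<le> real m / real d" by simp
    ultimately show ?thesis unfolding abs_le_iff by linarith
  next
    case False
    define k where "k = m - d"
    have m: "m = k + d" "k < m" using False d by (auto simp: k_def)
    obtain u where u: "\<And>i. i \<in> {k..<k + d} \<and> int d dvd x + 2 * int i \<longleftrightarrow> i = u"
      using ex1_dvd_in_block[OF assms, of k x] by blast
    have "{i. i < m \<and> int d dvd x + 2 * int i} = insert u {i. i < k \<and> int d dvd x + 2 * int i}"
    proof -
      have "i < m \<and> int d dvd x + 2 * int i \<longleftrightarrow> i = u \<or> i < k \<and> int d dvd x + 2 * int i" for i
        using u[of i] u[of u] m by (cases "i < k") auto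
      then show ?thesis by blast
    qed
    moreover have "u \<notin> {i. i < k \<and> int d dvd x + 2 * int i}" using u[of u] by auto
    ultimately have "card {i. i < m \<and> int d dvd x + 2 * int i}
      = Suc (card {i. i < k \<and> int d dvd x + 2 * int i})" by simp
    moreover have "real m / real d = real k / real d + 1" using d m by (simp add: field_simps)
    ultimately show ?thesis using less.IH[OF m(2)] by simp
  qed
qed

lemma prod_primes_dvd_iff:
  fixes E :: "nat set" and t :: int
  assumes "finite E" "\<And>p. p \<in> E \<Longrightarrow> prime p"
  shows "int (\<Prod>E) dvd t \<longleftrightarrow> (\<forall>p\<in>E. int p dvd t)"
  using assms
proof (induction E)
  case (insert p E)
  have "coprime p (\<Prod>E)"
    using insert by (intro prod_coprime_right) (metis insertCI primes_coprime)
  then have "coprime (int p) (int (\<Prod>E))" by (simp only: coprime_int_iff)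
  then have "int p * int (\<Prod>E) dvd t \<longleftrightarrow> int p dvd t \<and> int (\<Prod>E) dvd t"
    by (meson divides_mult dvd_mult_left dvd_mult_right)
  then show ?case using insert by simp
qed simp

text \<open>Double counting: E consists of divisors of a term exactly when its product divides the
  term. The predicate P serves both the truncated sum (\<open>card E \<le> r\<close>) and the full
  one (\<open>True\<close>).\<close>

lemma sum_subsets_of_divisors:
  fixes g :: "nat set \<Rightarrow> real" and x :: int
  assumes D: "finite D" "\<And>p. p \<in> D \<Longrightarrow> prime p"
  shows "(\<Sum>i<m. \<Sum>E | E \<subseteq> {p\<in>D. int p dvd x + 2 * int i} \<and> P E. g E)
    = (\<Sum>E | E \<subseteq> D \<and> P E. g E * real (card {i. i < m \<and> int (\<Prod>E) dvd x + 2 * int i}))"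
proof -
  have fin: "finite {E. E \<subseteq> D \<and> P E}" using D(1) by simp
  have "(\<Sum>E | E \<subseteq> {p\<in>D. int p dvd x + 2 * int i} \<and> P E. g E)
    = (\<Sum>E | E \<subseteq> D \<and> P E. if int (\<Prod>E) dvd x + 2 * int i then g E else 0)" for i
  proof -
    have "int (\<Prod>E) dvd x + 2 * int i \<longleftrightarrow> (\<forall>p\<in>E. int p dvd x + 2 * int i)" if "E \<subseteq> D" for E
      using that D by (intro prod_primes_dvd_iff) (auto dest: finite_subset)
    then have "{E. E \<subseteq> {p\<in>D. int p dvd x + 2 * int i} \<and> P E}
      = {E \<in> {E. E \<subseteq> D \<and> P E}. int (\<Prod>E) dvd x + 2 * int i}" by blast
    then show ?thesis
      by (simp only: sum.inter_filter[OF fin, of g "\<lambda>E. int (\<Prod>E) dvd x + 2 * int i"])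
  qed
  then have "(\<Sum>i<m. \<Sum>E | E \<subseteq> {p\<in>D. int p dvd x + 2 * int i} \<and> P E. g E)
    = (\<Sum>E | E \<subseteq> D \<and> P E. \<Sum>i<m. if int (\<Prod>E) dvd x + 2 * int i then g E else 0)"
    using sum.swap by simp
  also have "\<dots> = (\<Sum>E | E \<subseteq> D \<and> P E. g E * real (card {i. i < m \<and> int (\<Prod>E) dvd x + 2 * int i}))"
  proof (rule sum.cong[OF refl])
    fix E
    have "{i. i < m \<and> int (\<Prod>E) dvd x + 2 * int i} = {i\<in>{..<m}. int (\<Prod>E) dvd x + 2 * int i}"
      by auto
    then show "(\<Sum>i<m. if int (\<Prod>E) dvd x + 2 * int i then g E else 0)
      = g E * real (card {i. i < m \<and> int (\<Prod>E) dvd x + 2 * int i})"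
      by (simp add: sum.inter_filter[symmetric])
  qed
  finally show ?thesis .
qed

section \<open>Truncated inclusion-exclusion and its error terms\<close>

text \<open>Grouped by size, the sum is an alternating sum of binomial coefficients cut off at r,
  which for odd r equals \<open>- (real (card F) - 1 gchoose r)\<close>. This is at most 0 for
  nonempty F; for empty F the value of \<open>- 1 gchoose r\<close> is -1, so the sum is 1.\<close>

lemma bonferroni_indicator:
  assumes "finite F" "odd r"
  shows "(\<Sum>E | E \<subseteq> F \<and> card E \<le> r. (- 1) ^ card E) \<le> (if F = {} then 1 else 0 :: real)"
proof -
  have "(\<Sum>E | E \<subseteq> F \<and> card E \<le> r. (- 1) ^ card E :: real)
    = (\<Sum>k\<le>r. \<Sum>E | E \<in> {E. E \<subseteq> F \<and> card E \<le> r} \<and> card E = k. (- 1) ^ card E)"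
    using assms(1) by (subst sum.group) auto
  also have "\<dots> = (\<Sum>k\<le>r. (real (card F) gchoose k) * (- 1) ^ k)"
  proof (rule sum.cong[OF refl])
    fix k assume "k \<in> {..r}"
    then have "{E. E \<in> {E. E \<subseteq> F \<and> card E \<le> r} \<and> card E = k} = {E. E \<subseteq> F \<and> card E = k}"
      by auto
    then show "(\<Sum>E | E \<in> {E. E \<subseteq> F \<and> card E \<le> r} \<and> card E = k. (- 1) ^ card E :: real)
      = (real (card F) gchoose k) * (- 1) ^ k"
      using n_subsets[OF assms(1), of k] by (simp add: binomial_gbinomial)
  qed
  also have "\<dots> = - (real (card F) - 1 gchoose r)"
    using assms(2) by (simp add: gbinomial_sum_lower_neg)
  also have "\<dots> \<le> (if F = {} then 1 else 0)"
  proof (cases "F = {}")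
    case True
    have "(- 1 gchoose r :: real) = (- 1) ^ r * (of_nat r gchoose r)"
      using gbinomial_negated_upper[of "- 1 :: real" r] by simp
    then show ?thesis using True assms(2) by (simp flip: binomial_gbinomial)
  next
    case False
    then have "card F \<ge> 1" using assms(1) by (simp add: Suc_leI card_gt_0_iff)
    then have "real (card F) - 1 = real (card F - 1)" by simp
    then have "real (card F) - 1 gchoose r = real (card F - 1 choose r)"
      by (simp only: binomial_gbinomial)
    then show ?thesis using False by simp
  qed
  finally show ?thesis .
qed

lemma prod_one_add:
  fixes f :: "'a \<Rightarrow> real"
  assumes "finite A"
  shows "(\<Prod>a\<in>A. 1 + f a) = (\<Sum>E\<in>Pow A. \<Prod>a\<in>E. f a)"
  using prod_add[OF assms, of f "\<lambda>_. 1"] by (simp add: add.commute)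

text \<open>The elements are added in increasing order. An element above k others is at least k + 2,
  so its factor is at most (k + 2) / (k + 1), and these bounds telescope.\<close>

lemma prod_inflation_le:
  fixes D :: "nat set"
  assumes "finite D" "D \<subseteq> {2..}"
  shows "(\<Prod>p\<in>D. real p / (real p - 1)) \<le> real (card D) + 1"
  using assms
proof (induction D rule: finite_linorder_max_induct)
  case (insert b A)
  have "A \<subseteq> {2..<b}" using insert by auto
  then have "card A \<le> b - 2" using card_mono[of "{2..<b}" A] by simp
  moreover have b: "b \<ge> 2" using insert by auto
  ultimately have cb: "real (card A) + 2 \<le> real b" by linarith
  have "real b / (real b - 1) = 1 + 1 / (real b - 1)" using b by (simp add: field_simps)
  also have "\<dots> \<le> 1 + 1 / (real (card A) + 1)"
    using cb by (intro add_left_mono divide_left_mono) auto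
  also have "\<dots> = (real (card A) + 2) / (real (card A) + 1)" by (simp add: field_simps)
  finally have *: "real b / (real b - 1) \<le> (real (card A) + 2) / (real (card A) + 1)" .
  have "(\<Prod>p\<in>insert b A. real p / (real p - 1))
    = real b / (real b - 1) * (\<Prod>p\<in>A. real p / (real p - 1))"
    using insert.hyps by (subst prod.insert) auto
  also have "\<dots> \<le> (real (card A) + 2) / (real (card A) + 1) * (real (card A) + 1)"
    using * insert b by (intro mult_mono prod_nonneg) auto
  also have "\<dots> = real (card A) + 2" by (simp add: field_simps)
  also have "card (insert b A) = Suc (card A)" using insert.hyps by (subst card_insert_disjoint) auto
  then have "real (card A) + 2 = real (card (insert b A)) + 1" by simp
  finally show ?case .
qed simp

text \<open>Each subset counted has weight K ^ (r - card E) \<ge> 1. Summed over all subsets of D,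
  the weights give K ^ r * (1 + 1 / K) ^ card D, at most e * K ^ r.\<close>

lemma card_small_subsets_le:
  assumes "finite D" "card D \<le> K" "K \<ge> 1"
  shows "real (card {E. E \<subseteq> D \<and> card E \<le> r}) \<le> 3 * real K ^ r"
proof -
  have "real (card {E. E \<subseteq> D \<and> card E \<le> r}) = (\<Sum>E | E \<subseteq> D \<and> card E \<le> r. 1)" by simp
  also have "\<dots> \<le> (\<Sum>E | E \<subseteq> D \<and> card E \<le> r. real K ^ r * (\<Prod>p\<in>E. 1 / real K))"
  proof (rule sum_mono)
    fix E assume "E \<in> {E. E \<subseteq> D \<and> card E \<le> r}"
    then have "real K ^ card E \<le> real K ^ r" using assms by (intro power_increasing) auto
    then show "1 \<le> real K ^ r * (\<Prod>p\<in>E. 1 / real K)"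
      using assms by (simp add: power_divide field_simps)
  qed
  also have "\<dots> \<le> (\<Sum>E\<in>Pow D. real K ^ r * (\<Prod>p\<in>E. 1 / real K))"
    using assms by (intro sum_mono2 mult_nonneg_nonneg prod_nonneg) auto
  also have "\<dots> = real K ^ r * (1 + 1 / real K) ^ card D"
    using prod_one_add[OF assms(1), of "\<lambda>_. 1 / real K"] by (simp add: sum_distrib_left)
  also have "\<dots> \<le> real K ^ r * 3"
  proof (rule mult_left_mono)
    have "(1 + 1 / real K) ^ card D \<le> exp (1 / real K) ^ card D"
      by (intro power_mono exp_ge_add_one_self) auto
    also have "\<dots> = exp (real (card D) / real K)" by (simp add: exp_of_nat_mult[symmetric])
    also have "\<dots> \<le> exp 1" using assms by simp
    also have "\<dots> \<le> 3" by (rule exp_le)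
    finally show "(1 + 1 / real K) ^ card D \<le> 3" .
  qed simp
  finally show ?thesis by (simp add: mult.commute)
qed

text \<open>Rankin's trick: the tail carries the weight \<open>2 ^ (card E - r) \<ge> 1\<close>.\<close>

lemma tail_sum_le:
  fixes D :: "nat set"
  assumes "finite D" "D \<subseteq> {2..}" "card D \<le> K"
  shows "(\<Sum>E | E \<subseteq> D \<and> r < card E. \<Prod>p\<in>E. 1 / real p) \<le> (real K + 1)\<^sup>2 / 2 ^ r"
proof -
  have "(\<Sum>E | E \<subseteq> D \<and> r < card E. \<Prod>p\<in>E. 1 / real p)
    \<le> (\<Sum>E | E \<subseteq> D \<and> r < card E. (\<Prod>p\<in>E. 2 / real p) / 2 ^ r)"
  proof (rule sum_mono)
    fix E assume "E \<in> {E. E \<subseteq> D \<and> r < card E}"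
    then have "(2 :: real) ^ r \<le> 2 ^ card E" by (intro power_increasing) auto
    then have "(\<Prod>p\<in>E. 1 / real p) * 2 ^ r \<le> (\<Prod>p\<in>E. 1 / real p) * 2 ^ card E"
      by (intro mult_left_mono prod_nonneg) auto
    also have "\<dots> = (\<Prod>p\<in>E. 2 / real p)" by (simp add: prod_dividef)
    finally show "(\<Prod>p\<in>E. 1 / real p) \<le> (\<Prod>p\<in>E. 2 / real p) / 2 ^ r"
      by (simp add: field_simps)
  qed
  also have "\<dots> \<le> (\<Sum>E\<in>Pow D. (\<Prod>p\<in>E. 2 / real p) / 2 ^ r)"
    using assms by (intro sum_mono2 divide_nonneg_nonneg prod_nonneg) auto
  also have "\<dots> = (\<Prod>p\<in>D. 1 + 2 / real p) / 2 ^ r"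
    using prod_one_add[OF assms(1), of "\<lambda>p. 2 / real p"] by (simp add: sum_divide_distrib)
  also have "\<dots> \<le> (real K + 1)\<^sup>2 / 2 ^ r"
  proof (rule divide_right_mono)
    \<comment> \<open>The doubled weights cost only a square of the product of p / (p - 1), which is
      at most K + 1.\<close>
    have "(\<Prod>p\<in>D. 1 + 2 / real p) \<le> (\<Prod>p\<in>D. (real p / (real p - 1))\<^sup>2)"
    proof (rule prod_mono, intro conjI)
      fix p assume "p \<in> D"
      then have p: "real p \<ge> 2" using assms(2) by force
      have "1 + 2 / real p \<le> (1 + 1 / real p)\<^sup>2" by (simp add: power2_sum)
      also have "1 + 1 / real p \<le> real p / (real p - 1)" using p by (simp add: field_simps)
      then have "(1 + 1 / real p)\<^sup>2 \<le> (real p / (real p - 1))\<^sup>2" by (intro power_mono) auto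
      finally show "1 + 2 / real p \<le> (real p / (real p - 1))\<^sup>2" .
    qed simp
    also have "\<dots> = (\<Prod>p\<in>D. real p / (real p - 1))\<^sup>2"
      by (rule prod_power_distrib[symmetric])
    also have "\<dots> \<le> (real (card D) + 1)\<^sup>2"
      using assms(2) by (intro power_mono prod_inflation_le assms prod_nonneg) force
    also have "\<dots> \<le> (real K + 1)\<^sup>2" using assms(3) by (intro power_mono) auto
    finally show "(\<Prod>p\<in>D. 1 + 2 / real p) \<le> (real K + 1)\<^sup>2" .
  qed simp
  finally show ?thesis .
qed

text \<open>Three comparisons are chained. Truncating the expanded product at size r costs the tail
  sum. Replacing m / \<Prod>E by the true count costs at most 1 for each of the small subsets. The
  truncated sum of counts is at most the sifted count because r is odd.\<close>

lemma sieve_lower_bound: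
  fixes D :: "nat set" and x :: int
  assumes D: "finite D" "\<And>p. p \<in> D \<Longrightarrow> prime p \<and> odd p" "card D \<le> K"
    and K: "K \<ge> 1" and r: "odd r"
  shows "real m * (\<Prod>p\<in>D. 1 - 1 / real p) - real m * ((real K + 1)\<^sup>2 / 2 ^ r) - 3 * real K ^ r
    \<le> real (card {i. i < m \<and> (\<forall>p\<in>D. \<not> int p dvd x + 2 * int i)})"
proof -
  define c where "c E = real (card {i. i < m \<and> int (\<Prod>E) dvd x + 2 * int i})" for E
  define g where "g E = (\<Prod>p\<in>E. - (1 / real p))" for E :: "nat set"
  have D2: "D \<subseteq> {2..}" using D(2) by (auto intro: prime_ge_2_nat)
  have finE: "finite E" if "E \<subseteq> D" for E using that D(1) by (rule finite_subset)
  have g_eq: "g E = (- 1) ^ card E / real (\<Prod>E)" for E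
    by (simp add: g_def prod_uminus prod_dividef)
  have fin: "finite {E. E \<subseteq> D \<and> P E}" for P using D(1) by simp
  have "real m * (\<Prod>p\<in>D. 1 - 1 / real p) - real m * ((real K + 1)\<^sup>2 / 2 ^ r)
    \<le> real m * (\<Sum>E | E \<subseteq> D \<and> card E \<le> r. g E)"
  proof -
    have "(\<Prod>p\<in>D. 1 - 1 / real p) = (\<Sum>E\<in>Pow D. g E)"
      using prod_one_add[OF D(1), of "\<lambda>p. - (1 / real p)"] by (simp add: g_def)
    also have "Pow D = {E. E \<subseteq> D \<and> card E \<le> r} \<union> {E. E \<subseteq> D \<and> r < card E}" by auto
    also have "(\<Sum>E\<in>\<dots>. g E) = (\<Sum>E | E \<subseteq> D \<and> card E \<le> r. g E)
      + (\<Sum>E | E \<subseteq> D \<and> r < card E. g E)"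
      using fin by (intro sum.union_disjoint) auto
    also have "(\<Sum>E | E \<subseteq> D \<and> r < card E. g E)
      \<le> (\<Sum>E | E \<subseteq> D \<and> r < card E. \<Prod>p\<in>E. 1 / real p)"
    proof (rule sum_mono)
      fix E :: "nat set"
      have "g E \<le> \<bar>g E\<bar>" by simp
      also have "\<dots> = (\<Prod>p\<in>E. 1 / real p)" by (simp add: g_def abs_prod)
      finally show "g E \<le> (\<Prod>p\<in>E. 1 / real p)" .
    qed
    also have "\<dots> \<le> (real K + 1)\<^sup>2 / 2 ^ r" by (rule tail_sum_le[OF D(1) D2 D(3)])
    finally have "(\<Prod>p\<in>D. 1 - 1 / real p) - (real K + 1)\<^sup>2 / 2 ^ r
      \<le> (\<Sum>E | E \<subseteq> D \<and> card E \<le> r. g E)" by simp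
    then have "real m * ((\<Prod>p\<in>D. 1 - 1 / real p) - (real K + 1)\<^sup>2 / 2 ^ r)
      \<le> real m * (\<Sum>E | E \<subseteq> D \<and> card E \<le> r. g E)" by (rule mult_left_mono) simp
    then show ?thesis by (simp add: right_diff_distrib)
  qed
  moreover have "real m * (\<Sum>E | E \<subseteq> D \<and> card E \<le> r. g E) - real (card {E. E \<subseteq> D \<and> card E \<le> r})
    \<le> (\<Sum>E | E \<subseteq> D \<and> card E \<le> r. (- 1) ^ card E * c E)"
  proof -
    have "real m * (\<Sum>E | E \<subseteq> D \<and> card E \<le> r. g E) - real (card {E. E \<subseteq> D \<and> card E \<le> r})
      = (\<Sum>E | E \<subseteq> D \<and> card E \<le> r. real m * g E - 1)"
      by (simp add: sum_subtractf sum_distrib_left)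
    also have "\<dots> \<le> (\<Sum>E | E \<subseteq> D \<and> card E \<le> r. (- 1) ^ card E * c E)"
    proof (rule sum_mono)
      fix E assume "E \<in> {E. E \<subseteq> D \<and> card E \<le> r}"
      then have E: "E \<subseteq> D" by simp
      have "odd (\<Prod>E)" using D(2) E finE[OF E] by (subst even_prod_iff) auto
      then have "\<bar>c E - real m / real (\<Prod>E)\<bar> \<le> 1"
        unfolding c_def by (rule card_dvd_progression)
      moreover have "(- 1 :: real) ^ card E = 1 \<or> (- 1 :: real) ^ card E = - 1"
        by (cases "even (card E)") auto
      ultimately show "real m * g E - 1 \<le> (- 1) ^ card E * c E"
        unfolding g_eq by (auto simp: abs_le_iff)
    qed
    finally show ?thesis .
  qed
  moreover have "(\<Sum>E | E \<subseteq> D \<and> card E \<le> r. (- 1) ^ card E * c E)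
    \<le> real (card {i. i < m \<and> (\<forall>p\<in>D. \<not> int p dvd x + 2 * int i)})"
  proof -
    have "(\<Sum>E | E \<subseteq> D \<and> card E \<le> r. (- 1) ^ card E * c E)
      = (\<Sum>i<m. \<Sum>E | E \<subseteq> {p\<in>D. int p dvd x + 2 * int i} \<and> card E \<le> r. (- 1) ^ card E)"
      unfolding c_def using D by (intro sum_subsets_of_divisors[symmetric]) auto
    also have "\<dots> \<le> (\<Sum>i<m. if {p\<in>D. int p dvd x + 2 * int i} = {} then 1 else 0)"
      using D(1) r by (intro sum_mono bonferroni_indicator) auto
    also have "\<dots> = (\<Sum>i | i \<in> {..<m} \<and> {p\<in>D. int p dvd x + 2 * int i} = {}. 1)"
      by (subst sum.inter_filter) auto
    also have "{i. i \<in> {..<m} \<and> {p\<in>D. int p dvd x + 2 * int i} = {}}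
      = {i. i < m \<and> (\<forall>p\<in>D. \<not> int p dvd x + 2 * int i)}" by auto
    finally show ?thesis by simp
  qed
  moreover have "real (card {E. E \<subseteq> D \<and> card E \<le> r}) \<le> 3 * real K ^ r"
    by (rule card_small_subsets_le[OF D(1) D(3) K])
  ultimately show ?thesis by linarith
qed

section \<open>The third moment of the product of p / (p - 1) over a progression\<close>

text \<open>Expanding the product over subsets E of the divisors, each E contributes at most m /
  \<Prod>E + 1 terms of the progression. The two resulting sums over E fold back into the two
  products.\<close>

lemma sum_prod_divisors_le:
  fixes h :: "nat \<Rightarrow> real" and x :: int
  assumes Q: "finite Q" "\<And>p. p \<in> Q \<Longrightarrow> prime p \<and> odd p" and h: "\<And>p. p \<in> Q \<Longrightarrow> 0 \<le> h p"
  shows "(\<Sum>i<m. \<Prod>p | p \<in> Q \<and> int p dvd x + 2 * int i. 1 + h p)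
    \<le> real m * (\<Prod>p\<in>Q. 1 + h p / real p) + (\<Prod>p\<in>Q. 1 + h p)"
proof -
  have fin: "finite {p\<in>Q. int p dvd x + 2 * int i}" for i using Q(1) by simp
  have "(\<Sum>i<m. \<Prod>p | p \<in> Q \<and> int p dvd x + 2 * int i. 1 + h p)
    = (\<Sum>i<m. \<Sum>E | E \<subseteq> {p\<in>Q. int p dvd x + 2 * int i} \<and> True. \<Prod>p\<in>E. h p)"
    using prod_one_add[OF fin, of h] by (simp add: Pow_def)
  also have "\<dots> = (\<Sum>E | E \<subseteq> Q \<and> True.
      (\<Prod>p\<in>E. h p) * real (card {i. i < m \<and> int (\<Prod>E) dvd x + 2 * int i}))"
    using Q by (intro sum_subsets_of_divisors) auto
  also have "\<dots> \<le> (\<Sum>E | E \<subseteq> Q \<and> True. (\<Prod>p\<in>E. h p) * (real m / real (\<Prod>E) + 1))"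
  proof (intro sum_mono mult_left_mono)
    fix E assume "E \<in> {E. E \<subseteq> Q \<and> True}"
    then have E: "E \<subseteq> Q" by simp
    then show "0 \<le> (\<Prod>p\<in>E. h p)" using h by (intro prod_nonneg) auto
    have "finite E" using E Q(1) by (rule finite_subset)
    then have "odd (\<Prod>E)" using Q(2) E by (subst even_prod_iff) auto
    from card_dvd_progression[OF this, of m x]
    show "real (card {i. i < m \<and> int (\<Prod>E) dvd x + 2 * int i}) \<le> real m / real (\<Prod>E) + 1"
      by linarith
  qed
  also have "\<dots> = (\<Sum>E\<in>Pow Q. real m * (\<Prod>p\<in>E. h p / real p) + (\<Prod>p\<in>E. h p))"
    by (simp add: Pow_def prod_dividef distrib_left mult.commute)
  also have "\<dots> = real m * (\<Prod>p\<in>Q. 1 + h p / real p) + (\<Prod>p\<in>Q. 1 + h p)"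
    by (simp add: prod_one_add[OF Q(1)] sum.distrib sum_distrib_left)
  finally show ?thesis .
qed

text \<open>The telescoping bound \<open>1 / (i * i - 1)\<close> for the factor at \<open>2 * i + 1\<close> is used from
  \<open>i = 3\<close> on; the factors at 3 and 5 are too large for it.\<close>

lemma prod_cube_inflation_le:
  assumes "N \<ge> 2"
  shows "(\<Prod>i=1..N. 1 + ((real (2 * i + 1) / (real (2 * i + 1) - 1)) ^ 3 - 1) / real (2 * i + 1))
    \<le> 16 / 5 * (real N / (real N + 1))"
  using assms
proof (induction N rule: dec_induct)
  case base
  \<comment> \<open>The factors at 3 and 5 are 43/24 and 381/320. Their product 16383/7680 is just
    below 16384/7680 = (16/5) * (2/3), which explains the constant 16/5.\<close>
  have "{1..2::nat} = {1, 2}" by auto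
  then show ?case by (simp add: power3_eq_cube)
next
  case (step N)
  define j where "j = real N + 1"
  have j: "j \<ge> 3" using step by (simp add: j_def)
  have "((2 * j + 1) / (2 * j)) ^ 3 - 1 = (12 * j\<^sup>2 + 6 * j + 1) / (8 * j ^ 3)"
    using j by (simp add: field_simps power3_eq_cube power2_eq_square)
  moreover have "(12 * j\<^sup>2 + 6 * j + 1) / (8 * j ^ 3) / (2 * j + 1) \<le> 1 / (j\<^sup>2 - 1)"
  proof -
    have frac: "a / b \<le> 1 / d" if "a * d \<le> b" "b > 0" "d > 0" for a b d :: real
      using that by (simp add: field_simps)
    have "0 \<le> 4 * j\<^sup>2 + 2 * j - 1" using j zero_le_power2[of j] by linarith
    then have "0 \<le> j\<^sup>2 * (4 * j\<^sup>2 + 2 * j - 1)" by simp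
    then have "(12 * j\<^sup>2 + 6 * j + 1) * j\<^sup>2 \<le> 8 * j ^ 3 * (2 * j + 1)"
      by (simp add: algebra_simps power3_eq_cube power2_eq_square)
    then have "(12 * j\<^sup>2 + 6 * j + 1) / (8 * j ^ 3) / (2 * j + 1) \<le> 1 / j\<^sup>2"
      using j frac by simp
    \<comment> \<open>Weakened so that the new factor becomes j^2 / ((j - 1) * (j + 1)) and
      telescopes.\<close>
    also have "\<dots> \<le> 1 / (j\<^sup>2 - 1)"
      using j one_less_power[of j 2] by (intro divide_left_mono) auto
    finally show ?thesis .
  qed
  ultimately have *: "1 + (((2 * j + 1) / (2 * j)) ^ 3 - 1) / (2 * j + 1) \<le> 1 + 1 / (j\<^sup>2 - 1)"
    by simp
  have "(1 + 1 / (j\<^sup>2 - 1)) * ((j - 1) / j) = j / (j + 1)"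
  proof -
    have "j\<^sup>2 - 1 = (j - 1) * (j + 1)" by (simp add: power2_eq_square algebra_simps)
    moreover have "j - 1 \<noteq> 0" "j + 1 \<noteq> 0" "j \<noteq> 0" "j * j \<noteq> 1"
      using j mult_mono[of 3 j 3 j] by auto
    ultimately show ?thesis by (simp add: field_simps)
  qed
  have "0 \<le> 1 + 1 / (j\<^sup>2 - 1)" using j one_less_power[of j 2] by simp
  have nonneg: "0 \<le> 1 + ((real (2 * i + 1) / (real (2 * i + 1) - 1)) ^ 3 - 1) / real (2 * i + 1)"
    if "i \<ge> 1" for i
  proof -
    have "1 \<le> (real (2 * i + 1) / (real (2 * i + 1) - 1)) ^ 3"
      using that by (intro one_le_power) simp
    then show ?thesis by simp
  qed
  have "(\<Prod>i=1..Suc N. 1 + ((real (2 * i + 1) / (real (2 * i + 1) - 1)) ^ 3 - 1) / real (2 * i + 1))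
    = (1 + (((2 * j + 1) / (2 * j)) ^ 3 - 1) / (2 * j + 1)) *
      (\<Prod>i=1..N. 1 + ((real (2 * i + 1) / (real (2 * i + 1) - 1)) ^ 3 - 1) / real (2 * i + 1))"
    by (subst prod.nat_ivl_Suc') (auto simp: j_def algebra_simps)
  also have "\<dots> \<le> (1 + 1 / (j\<^sup>2 - 1)) * (16 / 5 * (real N / (real N + 1)))"
    using * \<open>0 \<le> 1 + 1 / (j\<^sup>2 - 1)\<close>
    by (intro mult_mono step.IH prod_nonneg nonneg) auto
  also have "\<dots> = 16 / 5 * ((1 + 1 / (j\<^sup>2 - 1)) * ((j - 1) / j))" by (simp add: j_def)
  also have "\<dots> = 16 / 5 * (real (Suc N) / (real (Suc N) + 1))"
    using \<open>(1 + 1 / (j\<^sup>2 - 1)) * ((j - 1) / j) = j / (j + 1)\<close> by (simp add: j_def add_ac)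
  finally show ?case .
qed

section \<open>Hall's condition for two progressions of opposite parity\<close>

lemma finite_prime_divisors:
  fixes t :: int
  assumes "t > 0"
  shows "finite {p::nat. prime p \<and> odd p \<and> int p dvd t}"
proof (rule finite_subset)
  show "{p::nat. prime p \<and> odd p \<and> int p dvd t} \<subseteq> {..nat t}"
    using assms zdvd_imp_le by (fastforce simp: le_nat_iff)
qed simp

lemma card_prime_divisors_le:
  fixes t :: int
  assumes "t > 0" "t \<le> 2 ^ K"
  shows "card {p::nat. prime p \<and> odd p \<and> int p dvd t} \<le> K"
proof -
  define D where "D = {p::nat. prime p \<and> odd p \<and> int p dvd t}"
  have fin: "finite D" unfolding D_def by (rule finite_prime_divisors[OF assms(1)])
  have "(2::nat) ^ card D = (\<Prod>p\<in>D. 2)" by simp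
  also have "\<dots> \<le> \<Prod>D" by (rule prod_mono) (auto simp: D_def intro: prime_ge_2_nat)
  finally have "int (2 ^ card D) \<le> int (\<Prod>D)" by (simp only: of_nat_le_iff)
  also have "int (\<Prod>D) \<le> t"
    using assms(1) by (intro zdvd_imp_le, subst prod_primes_dvd_iff[OF fin]) (auto simp: D_def)
  also note assms(2)
  finally have "(2::int) ^ card D \<le> 2 ^ K" by (simp only: of_nat_power of_nat_numeral)
  then have "card D \<le> K" by (rule power_le_imp_le_exp[rotated]) simp
  then show ?thesis by (simp add: D_def)
qed

lemma prod_inflation_inverse:
  fixes D :: "nat set"
  assumes "D \<subseteq> {2..}"
  shows "(\<Prod>p\<in>D. real p / (real p - 1)) * (\<Prod>p\<in>D. 1 - 1 / real p) = 1"
  unfolding prod.distrib[symmetric]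
proof (rule prod.neutral, rule ballI)
  fix p assume "p \<in> D"
  then have "real p \<ge> 2" using assms by force
  then show "real p / (real p - 1) * (1 - 1 / real p) = 1" by (simp add: field_simps)
qed

text \<open>The sieve bound is multiplied by F, the inverse of the density f. As F \<le> K + 1, the
  condition on r makes the tail error at most m / 100, and the condition on m does the same for the
  rounding error.\<close>

lemma sieve_ratio:
  fixes D :: "nat set" and y :: int
  assumes D: "finite D" "\<And>p. p \<in> D \<Longrightarrow> prime p \<and> odd p" "card D \<le> K"
    and K: "K \<ge> 1" and r: "odd r" "100 * (K + 1) ^ 3 \<le> 2 ^ r"
    and m: "300 * (K + 1) ^ (r + 1) \<le> m"
  shows "98 / 100 * real m \<le> real (card {i. i < m \<and> (\<forall>p\<in>D. \<not> int p dvd y + 2 * int i)})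
    * (\<Prod>p\<in>D. real p / (real p - 1))"
proof -
  define c where "c = real (card {i. i < m \<and> (\<forall>p\<in>D. \<not> int p dvd y + 2 * int i)})"
  define F where "F = (\<Prod>p\<in>D. real p / (real p - 1))"
  define f where "f = (\<Prod>p\<in>D. 1 - 1 / real p)"
  define k where "k = real K + 1"
  have D2: "D \<subseteq> {2..}" using D(2) by (auto intro: prime_ge_2_nat)
  have Ff: "F * f = 1" unfolding F_def f_def by (rule prod_inflation_inverse[OF D2])
  have F: "0 \<le> F" "F \<le> k"
  proof -
    show "0 \<le> F" unfolding F_def using D2 by (intro prod_nonneg) force
    have "F \<le> real (card D) + 1" unfolding F_def by (rule prod_inflation_le[OF D(1) D2])
    then show "F \<le> k" using D(3) by (simp add: k_def)
  qed
  have k: "k \<ge> 1" by (simp add: k_def)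
  have r': "100 * k ^ 3 \<le> 2 ^ r"
  proof -
    have "real (100 * (K + 1) ^ 3) \<le> real (2 ^ r)" using r(2) by (simp only: of_nat_le_iff)
    then show ?thesis by (simp add: k_def add.commute)
  qed
  have m': "300 * k ^ (r + 1) \<le> real m"
  proof -
    have "real (300 * (K + 1) ^ (r + 1)) \<le> real m" using m by (simp only: of_nat_le_iff)
    then show ?thesis by (simp add: k_def add.commute algebra_simps)
  qed
  have "F * (real m * f - real m * (k\<^sup>2 / 2 ^ r) - 3 * real K ^ r) \<le> F * c"
    using F(1) sieve_lower_bound[OF D K r(1), of m y]
    by (intro mult_left_mono) (simp_all add: c_def f_def k_def)
  then have "real m * (F * f) - real m * (F * k\<^sup>2 / 2 ^ r) - 3 * real K ^ r * F \<le> c * F"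
    by (simp add: algebra_simps)
  moreover have "real m * (F * k\<^sup>2 / 2 ^ r) \<le> real m * (1 / 100)"
  proof (rule mult_left_mono)
    have "F * k\<^sup>2 \<le> k * k\<^sup>2" using F by (intro mult_right_mono) auto
    also have "\<dots> = k ^ 3" by (simp add: power3_eq_cube power2_eq_square)
    finally show "F * k\<^sup>2 / 2 ^ r \<le> 1 / 100" using r' by (simp add: field_simps)
  qed simp
  moreover have "3 * real K ^ r * F \<le> real m * (1 / 100)"
  proof -
    have "3 * real K ^ r * F \<le> 3 * k ^ r * k"
      using F k by (intro mult_mono power_mono) (auto simp: k_def)
    also have "\<dots> = 3 * k ^ (r + 1)" by simp
    finally show ?thesis using m' by linarith
  qed
  ultimately show ?thesis using Ff unfolding c_def[symmetric] F_def[symmetric] by simp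
qed

text \<open>At most K members of D exceed 100 K, and each of them has 1 - 1 / p \<ge> 1 - 1 / (100
  K). By Bernoulli's inequality their joint factor is at least 99/100. Restricting to small primes
  keeps the error term of the third moment polynomial in K.\<close>

lemma small_primes_inflation:
  fixes D :: "nat set"
  assumes D: "finite D" "D \<subseteq> {2..}" "card D \<le> K" and K: "K \<ge> 1"
  shows "99 / 100 * (\<Prod>p\<in>D. real p / (real p - 1))
    \<le> (\<Prod>p | p \<in> D \<and> p \<le> 100 * K. real p / (real p - 1))"
proof -
  define B where "B = {p\<in>D. \<not> p \<le> 100 * K}"
  define F where "F E = (\<Prod>p\<in>E. real p / (real p - 1))" for E :: "nat set"
  have pos: "0 \<le> F E" if "E \<subseteq> D" for E unfolding F_def using D(2) that by (intro prod_nonneg) force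
  have B: "B \<subseteq> D" "finite B" using D(1) by (auto simp: B_def)
  have "99 / 100 \<le> 1 - real (card B) * (1 / (100 * real K))"
    using card_mono[OF D(1) B(1)] D(3) K by (simp add: field_simps)
  also have "\<dots> \<le> (1 - 1 / (100 * real K)) ^ card B"
    using Bernoulli_inequality[of "- (1 / (100 * real K))" "card B"] K by (simp add: field_simps)
  also have "\<dots> = (\<Prod>p\<in>B. 1 - 1 / (100 * real K))" by simp
  also have "\<dots> \<le> (\<Prod>p\<in>B. 1 - 1 / real p)"
  proof (rule prod_mono, intro conjI)
    fix p assume "p \<in> B"
    then have "100 * real K \<le> real p" by (simp add: B_def not_le)
    then show "1 - 1 / (100 * real K) \<le> 1 - 1 / real p" using K by (simp add: frac_le)
    show "0 \<le> 1 - 1 / (100 * real K)" using K by (simp add: field_simps)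
  qed
  finally have "F B * (99 / 100) \<le> F B * (\<Prod>p\<in>B. 1 - 1 / real p)"
    by (intro mult_left_mono pos B)
  also have "\<dots> = 1"
    unfolding F_def using B D(2) by (intro prod_inflation_inverse) blast
  finally have "F {p\<in>D. p \<le> 100 * K} * (F B * (99 / 100)) \<le> F {p\<in>D. p \<le> 100 * K} * 1"
    by (intro mult_left_mono pos) auto
  moreover have "F D = F {p\<in>D. p \<le> 100 * K} * F B"
  proof -
    have "D = {p\<in>D. p \<le> 100 * K} \<union> B" by (auto simp: B_def)
    then have "F D = F ({p\<in>D. p \<le> 100 * K} \<union> B)" by simp
    also have "\<dots> = F {p\<in>D. p \<le> 100 * K} * F B"
      unfolding F_def using D(1) B by (intro prod.union_disjoint) (auto simp: B_def)
    finally show ?thesis .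
  qed
  ultimately show ?thesis by (simp add: F_def algebra_simps)
qed

text \<open>The cube is a product of factors 1 + h p over the divisors in Q, so the expansion above
  applies. In the main term Q is enlarged to all odd numbers from 3 to 100 K + 1; in the error term
  the product over Q of p / (p - 1) is at most card Q + 1 \<le> 100 K.\<close>

lemma third_moment_inflation:
  fixes x :: int
  assumes K: "K \<ge> 1"
  shows "(\<Sum>i<m. (\<Prod>p | prime p \<and> odd p \<and> p \<le> 100 * K \<and> int p dvd x + 2 * int i.
      real p / (real p - 1)) ^ 3) \<le> 16 / 5 * real m + (100 * real K) ^ 3"
proof -
  define Q where "Q = {p::nat. prime p \<and> odd p \<and> p \<le> 100 * K}"
  define h where "h p = (real p / (real p - 1)) ^ 3 - 1" for p :: nat
  have fin: "finite Q" unfolding Q_def by simp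
  have Q2: "Q \<subseteq> {2..100 * K}" by (auto simp: Q_def intro: prime_ge_2_nat)
  have h: "0 \<le> h p" if "p \<ge> 2" for p
    using that by (simp add: h_def field_simps)
  have "(\<Sum>i<m. (\<Prod>p | prime p \<and> odd p \<and> p \<le> 100 * K \<and> int p dvd x + 2 * int i.
      real p / (real p - 1)) ^ 3)
    = (\<Sum>i<m. \<Prod>p | p \<in> Q \<and> int p dvd x + 2 * int i. 1 + h p)"
    by (simp add: h_def prod_power_distrib Q_def conj_assoc)
  also have "\<dots> \<le> real m * (\<Prod>p\<in>Q. 1 + h p / real p) + (\<Prod>p\<in>Q. 1 + h p)"
    using fin Q2 by (intro sum_prod_divisors_le) (auto simp: Q_def intro!: h prime_ge_2_nat)
  also have "\<dots> \<le> real m * (16 / 5) + (100 * real K) ^ 3"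
  proof (intro add_mono mult_left_mono)
    have "(\<Prod>p\<in>Q. 1 + h p / real p) \<le> (\<Prod>p\<in>(\<lambda>i. 2 * i + 1) ` {1..50 * K}. 1 + h p / real p)"
    proof (rule prod_mono2)
      show "Q \<subseteq> (\<lambda>i. 2 * i + 1) ` {1..50 * K}"
      proof
        fix p assume p: "p \<in> Q"
        then obtain i where i: "p = 2 * i + 1" by (auto simp: Q_def elim: oddE)
        then show "p \<in> (\<lambda>i. 2 * i + 1) ` {1..50 * K}" using p Q2 by fastforce
      qed
      show "1 \<le> 1 + h p / real p" if "p \<in> (\<lambda>i. 2 * i + 1) ` {1..50 * K} - Q" for p
        using that h[of p] by auto
      show "0 \<le> 1 + h p / real p" if "p \<in> Q" for p
        using that h[of p] Q2 by fastforce
    qed simp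
    also have "\<dots> = (\<Prod>i=1..50 * K. 1 + h (2 * i + 1) / real (2 * i + 1))"
      by (subst prod.reindex) (auto simp: inj_on_def)
    also have "\<dots> \<le> 16 / 5 * (real (50 * K) / (real (50 * K) + 1))"
      unfolding h_def using K by (intro prod_cube_inflation_le) simp
    also have "\<dots> \<le> 16 / 5 * 1" by (intro mult_left_mono) (simp_all add: divide_le_eq)
    finally show "(\<Prod>p\<in>Q. 1 + h p / real p) \<le> 16 / 5" by simp
    have "card Q + 1 \<le> 100 * K" using card_mono[OF _ Q2] K by simp
    then have "real (card Q) + 1 \<le> 100 * real K" by linarith
    moreover have "(\<Prod>p\<in>Q. real p / (real p - 1)) \<le> real (card Q) + 1"
      using Q2 by (intro prod_inflation_le fin) auto
    ultimately have "(\<Prod>p\<in>Q. real p / (real p - 1)) ^ 3 \<le> (100 * real K) ^ 3"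
      using Q2 by (intro power_mono prod_nonneg) force+
    then show "(\<Prod>p\<in>Q. 1 + h p) \<le> (100 * real K) ^ 3"
      by (simp add: h_def prod_power_distrib)
  qed simp
  finally show ?thesis by (simp add: mult.commute)
qed

text \<open>If there were no coprime pair, every index in T would have F at least about m / q with q
  = m - card S. More than q such indices are too many for the third moment, given q \<le> m /
  2.\<close>

lemma no_large_independent_pair:
  fixes x y :: int and S T :: "nat set"
  assumes x: "\<And>i. i < m \<Longrightarrow> 0 < x + 2 * int i \<and> x + 2 * int i \<le> 2 ^ K"
    and xy: "odd (x + y)"
    and K: "K \<ge> 1" and r: "odd r" "100 * (K + 1) ^ 3 \<le> 2 ^ r"
    and m: "10 ^ 8 * (K + 1) ^ (r + 1) \<le> m"
    and T: "T \<subseteq> {..<m}" and S: "S \<subseteq> {..<m}" and big: "m < card T + card S" "m \<le> 2 * card S"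
  shows "\<exists>i\<in>T. \<exists>j\<in>S. coprime (x + 2 * int i) (y + 2 * int j)"
proof (rule ccontr)
  assume contra: "\<not> ?thesis"
  define q where "q = m - card S"
  define F where "F i = (\<Prod>p | prime p \<and> odd p \<and> p \<le> 100 * K \<and> int p dvd x + 2 * int i.
      real p / (real p - 1))" for i :: nat
  have m300: "300 * (K + 1) ^ (r + 1) \<le> m"
  proof -
    have "300 * (K + 1) ^ (r + 1) \<le> 10 ^ 8 * (K + 1) ^ (r + 1)" by (intro mult_right_mono) auto
    then show ?thesis using m by linarith
  qed
  have m0: "m > 0" using m by (cases m) auto
  have F: "97 / 100 * real m \<le> real q * F i" if i: "i \<in> T" for i
  proof -
    define t where "t = x + 2 * int i"
    define D where "D = {p::nat. prime p \<and> odd p \<and> int p dvd t}"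
    define C where "C = {j. j < m \<and> (\<forall>p\<in>D. \<not> int p dvd y + 2 * int j)}"
    have t: "0 < t" "t \<le> 2 ^ K" using x[of i] i T by (auto simp: t_def)
    have D: "finite D" "card D \<le> K" "D \<subseteq> {2..}"
      unfolding D_def using finite_prime_divisors card_prime_divisors_le t
      by (auto intro: prime_ge_2_nat)
    have "C \<subseteq> {..<m} - S"
    proof
      fix j assume j: "j \<in> C"
      have "coprime t (y + 2 * int j)"
      proof (rule ccontr)
        assume "\<not> coprime t (y + 2 * int j)"
        then obtain d where d: "d dvd t" "d dvd y + 2 * int j" "\<not> is_unit d"
          by (auto elim: not_coprimeE)
        have "d \<noteq> 0" using d(1) t by auto
        then obtain p where p: "prime p" "p dvd d" using prime_divisorE d(3) by blast
        then have p': "p dvd t" "p dvd y + 2 * int j" using d by (auto dest: dvd_trans)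
        \<comment> \<open>Terms of the two progressions have opposite parity, so a common prime
          divisor is odd and belongs to D.\<close>
        have "odd (t + (y + 2 * int j))" using xy by (simp add: t_def)
        then have "odd p" using p' by (meson dvd_add dvd_trans)
        moreover have "int (nat p) = p" using p(1) prime_ge_0_int by simp
        moreover have "prime (nat p)" using p(1) \<open>int (nat p) = p\<close> by (metis prime_int_nat_transfer)
        ultimately have "nat p \<in> D"
          using p'(1) unfolding D_def by (metis (mono_tags, lifting) even_of_nat mem_Collect_eq)
        then show False using j p'(2) \<open>int (nat p) = p\<close> unfolding C_def by fastforce
      qed
      then show "j \<in> {..<m} - S" using j contra i unfolding C_def t_def by blast
    qed
    then have "card C \<le> card ({..<m} - S)" by (intro card_mono) auto
    also have "\<dots> = q" using S by (simp add: card_Diff_subset finite_subset q_def)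
    finally have C: "real (card C) \<le> real q" by simp
    have DF: "99 / 100 * (\<Prod>p\<in>D. real p / (real p - 1)) \<le> F i"
      using small_primes_inflation[OF D(1) D(3) D(2) K]
      unfolding F_def D_def t_def by (simp add: conj_ac)
    have "98 / 100 * real m \<le> real (card C) * (\<Prod>p\<in>D. real p / (real p - 1))"
      unfolding C_def using D by (intro sieve_ratio[OF _ _ _ K r m300]) (auto simp: D_def)
    also have "\<dots> \<le> real q * (\<Prod>p\<in>D. real p / (real p - 1))"
      using C D(3) by (intro mult_right_mono prod_nonneg) force+
    \<comment> \<open>The sieve loses 2/100 and the omission of large primes 1/100; 0.98 * 0.99
      still exceeds 0.97.\<close>
    also have "\<dots> \<le> real q * (100 / 99 * F i)" using DF by (intro mult_left_mono) auto
    finally show ?thesis using m0 by simp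
  qed
  have "q + 1 \<le> card T" "2 * q \<le> m"
    using big card_mono[OF _ S] by (simp_all add: q_def)
  then have q: "real q + 1 \<le> real (card T)" "2 * real q \<le> real m" by linarith+
  have "real (card T) * (97 / 100 * real m) ^ 3 = (\<Sum>i\<in>T. (97 / 100 * real m) ^ 3)" by simp
  also have "\<dots> \<le> (\<Sum>i\<in>T. (real q * F i) ^ 3)" using F by (intro sum_mono power_mono) auto
  also have "\<dots> \<le> (\<Sum>i<m. (real q * F i) ^ 3)"
  proof (intro sum_mono2 T)
    fix i show "0 \<le> (real q * F i) ^ 3" unfolding F_def
      by (intro zero_le_power mult_nonneg_nonneg prod_nonneg) (auto dest: prime_gt_1_nat)
  qed simp
  also have "\<dots> = real q ^ 3 * (\<Sum>i<m. F i ^ 3)" by (simp add: power_mult_distrib sum_distrib_left)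
  also have "\<dots> \<le> real q ^ 3 * (16 / 5 * real m + (100 * real K) ^ 3)"
    unfolding F_def by (intro mult_left_mono third_moment_inflation K) auto
  also have "\<dots> \<le> real q ^ 3 * (33 / 10 * real m)"
  proof (intro mult_left_mono)
    \<comment> \<open>This makes m at least 10^8 * K^3, so that (100 K)^3 fits into the gap m / 10
      between 16/5 and 33/10.\<close>
    have "r \<ge> 3"
    proof (rule ccontr)
      assume "\<not> 3 \<le> r"
      then have "(2::nat) ^ r \<le> 2 ^ 2" by (intro power_increasing) auto
      moreover have "(2::nat) ^ 2 = 4" by simp
      moreover have "1 \<le> (K + 1) ^ 3" by simp
      ultimately show False using r(2) by linarith
    qed
    then have "(K + 1) ^ 3 \<le> (K + 1) ^ (r + 1)" by (intro power_increasing) auto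
    moreover have "K ^ 3 \<le> (K + 1) ^ 3" by (intro power_mono) auto
    ultimately have "10 ^ 8 * K ^ 3 \<le> m" using m by (meson le_trans mult_le_mono2)
    then have "real (10 ^ 8 * K ^ 3) \<le> real m" by (simp only: of_nat_le_iff)
    then have "10 ^ 8 * real K ^ 3 \<le> real m" by simp
    then show "16 / 5 * real m + (100 * real K) ^ 3 \<le> 33 / 10 * real m"
      by (simp add: power_mult_distrib)
  qed simp
  finally have main: "real (card T) * (97 / 100 * real m) ^ 3 \<le> real q ^ 3 * (33 / 10 * real m)" .
  \<comment> \<open>One factor q is bounded by card T and cancels; the other two give (m / 2)^2.
    What remains is 0.97^3 \<le> 33/40, which is false as 0.97^3 > 0.91.\<close>
  have "real q ^ 3 * (33 / 10 * real m) = real q * (real q)\<^sup>2 * (33 / 10 * real m)"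
    by (simp add: power3_eq_cube power2_eq_square)
  also have "\<dots> \<le> real q * (real m / 2)\<^sup>2 * (33 / 10 * real m)"
    using q by (intro mult_right_mono mult_left_mono power_mono) auto
  also have "\<dots> \<le> real (card T) * (33 / 40 * real m ^ 3)"
    using mult_right_mono[of "real q" "real (card T)" "33 / 40 * real m ^ 3"] q
    by (simp add: power3_eq_cube power2_eq_square)
  finally have "real (card T) * (97 / 100 * real m) ^ 3 \<le> real (card T) * (33 / 40 * real m ^ 3)"
    using main by linarith
  moreover have "real (card T) > 0" using q by linarith
  ultimately have "(97 / 100 * real m) ^ 3 \<le> 33 / 40 * real m ^ 3"
    by (simp only: mult_le_cancel_left_pos)
  then show False using m0 by (simp add: power3_eq_cube)
qed

text \<open>A violator J of Hall's condition has no coprime pair with the set S of indices outside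
  its neighbourhood, and card J + card S > m. One of the two thus has at least m / 2 elements. If it
  is J, the progressions exchange roles, which is why both must satisfy the range bound.\<close>

lemma coprime_matching_progressions:
  fixes x y :: int
  assumes x: "\<And>i. i < m \<Longrightarrow> 0 < x + 2 * int i \<and> x + 2 * int i \<le> 2 ^ K"
    and y: "\<And>i. i < m \<Longrightarrow> 0 < y + 2 * int i \<and> y + 2 * int i \<le> 2 ^ K"
    and xy: "odd (x + y)"
    and K: "K \<ge> 1" and r: "odd r" "100 * (K + 1) ^ 3 \<le> 2 ^ r"
    and m: "10 ^ 8 * (K + 1) ^ (r + 1) \<le> m"
  shows "\<exists>f. bij_betw f {..<m} {..<m} \<and> (\<forall>i<m. coprime (x + 2 * int i) (y + 2 * int (f i)))"
proof -
  define N where "N i = {j. j < m \<and> coprime (x + 2 * int i) (y + 2 * int j)}" for i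
  have "\<exists>f. inj_on f {..<m} \<and> (\<forall>i\<in>{..<m}. f i \<in> N i)"
  proof (rule hall)
    fix J assume J: "J \<subseteq> {..<m}"
    show "card J \<le> card (\<Union>(N ` J))"
    proof (rule ccontr)
      assume less: "\<not> ?thesis"
      define S where "S = {..<m} - \<Union>(N ` J)"
      have sub: "\<Union>(N ` J) \<subseteq> {..<m}" by (auto simp: N_def)
      then have "card S = m - card (\<Union>(N ` J))"
        unfolding S_def by (simp add: card_Diff_subset finite_subset)
      moreover have "card (\<Union>(N ` J)) \<le> m" using card_mono[OF _ sub] by simp
      ultimately have big: "m < card J + card S" using less by linarith
      have S: "S \<subseteq> {..<m}" by (auto simp: S_def)
      have no: "\<not> coprime (x + 2 * int i) (y + 2 * int j)" if "i \<in> J" "j \<in> S" for i j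
        using that by (auto simp: S_def N_def)
      show False
      proof (cases "m \<le> 2 * card S")
        case True
        then show False
          using no_large_independent_pair[OF x xy K r m J S big] no by blast
      next
        case False
        then have "m \<le> 2 * card J" "m < card S + card J" "odd (y + x)"
          using big xy by (simp_all add: add.commute)
        then show False
          using no_large_independent_pair[OF y _ K r m S J, of x] no coprime_commute by metis
      qed
    qed
  qed (auto simp: N_def)
  then obtain f where f: "inj_on f {..<m}" "\<forall>i\<in>{..<m}. f i \<in> N i" by blast
  have "f ` {..<m} \<subseteq> {..<m}" using f(2) by (auto simp: N_def)
  then have "f ` {..<m} = {..<m}" by (rule endo_inj_surj[OF finite_lessThan _ f(1)])
  then have "bij_betw f {..<m} {..<m}" using f(1) by (simp add: bij_betw_def)
  then show ?thesis using f(2) by (auto simp: N_def)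
qed

section \<open>Intervals\<close>

lemma coprime_mapping_intervals:
  fixes a b :: int
  assumes A: "{a..<a + int (2 * m)} \<subseteq> {1..2 ^ K}" and B: "{b..<b + int (2 * m)} \<subseteq> {1..2 ^ K}"
    and K: "K \<ge> 1" and r: "odd r" "100 * (K + 1) ^ 3 \<le> 2 ^ r"
    and m: "10 ^ 8 * (K + 1) ^ (r + 1) \<le> m"
  shows "\<exists>g. coprime_mapping g {a..<a + int (2 * m)} {b..<b + int (2 * m)}"
proof -
  \<comment> \<open>The shift that makes b + e differ in parity from a; then b + (1 - e) differs in
    parity from a + 1.\<close>
  define e :: int where "e = (if odd (a + b) then 0 else 1)"
  have e: "e = 0 \<or> e = 1" "odd (a + (b + e))" "odd ((a + 1) + (b + (1 - e)))"
    by (auto simp: e_def)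
  have range: "0 < c + d + 2 * int i \<and> c + d + 2 * int i \<le> 2 ^ K"
    if "{c..<c + int (2 * m)} \<subseteq> {1..2 ^ K}" "d = 0 \<or> d = 1" "i < m" for c d :: int and i
  proof -
    have "c + d + 2 * int i \<in> {c..<c + int (2 * m)}" using that by auto
    then show ?thesis using that(1) by fastforce
  qed
  have "\<exists>f. bij_betw f {..<m} {..<m} \<and> (\<forall>i<m. coprime (a + 2 * int i) (b + e + 2 * int (f i)))"
    using range[OF A, of 0] range[OF B e(1)] e(2)
    by (intro coprime_matching_progressions[OF _ _ _ K r m]) auto
  then obtain f where f: "bij_betw f {..<m} {..<m}"
    "\<And>i. i < m \<Longrightarrow> coprime (a + 2 * int i) (b + e + 2 * int (f i))" by blast
  have "\<exists>f. bij_betw f {..<m} {..<m} \<and>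
      (\<forall>i<m. coprime (a + 1 + 2 * int i) (b + (1 - e) + 2 * int (f i)))"
    using range[OF A, of 1] range[OF B, of "1 - e"] e
    by (intro coprime_matching_progressions[OF _ _ _ K r m]) auto
  then obtain f' where f': "bij_betw f' {..<m} {..<m}"
    "\<And>i. i < m \<Longrightarrow> coprime (a + 1 + 2 * int i) (b + (1 - e) + 2 * int (f' i))" by blast
  \<comment> \<open>The two matchings are glued: the parity of z - a selects the progression and its
    half is the index there.\<close>
  define g where "g z = (if even (z - a) then b + e + 2 * int (f (nat ((z - a) div 2)))
    else b + (1 - e) + 2 * int (f' (nat ((z - a) div 2))))" for z
  have index: "nat ((z - a) div 2) < m" if "z \<in> {a..<a + int (2 * m)}" for z
    using that by auto
  have z_even: "z = a + 2 * int (nat ((z - a) div 2))" if "z \<ge> a" "even (z - a)" for z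
    using that by simp
  have z_odd: "z = a + 1 + 2 * int (nat ((z - a) div 2))" if "z \<ge> a" "odd (z - a)" for z
  proof -
    have "(z - a) div 2 \<ge> 0" using that(1) by simp
    then have "int (nat ((z - a) div 2)) = (z - a) div 2" by (rule nat_0_le)
    then show ?thesis using odd_two_times_div_two_succ[OF that(2)] by linarith
  qed
  have f_less: "f i < m" "f' i < m" if "i < m" for i
    using that f(1) f'(1) by (auto simp: bij_betw_def)
  have sub: "g ` {a..<a + int (2 * m)} \<subseteq> {b..<b + int (2 * m)}"
  proof (rule image_subsetI)
    fix z assume "z \<in> {a..<a + int (2 * m)}"
    from f_less[OF index[OF this]] show "g z \<in> {b..<b + int (2 * m)}"
      using e(1) by (auto simp: g_def)
  qed
  \<comment> \<open>The images of the two halves have different parities, so injectivity can be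
    checked on each half alone.\<close>
  have g_parity: "even (g z - b - e) \<longleftrightarrow> even (z - a)" for z
    using e(1) by (auto simp: g_def)
  have "inj_on g {a..<a + int (2 * m)}"
  proof (rule inj_onI)
    fix z z' assume z: "z \<in> {a..<a + int (2 * m)}" "z' \<in> {a..<a + int (2 * m)}" "g z = g z'"
    then have ge: "z \<ge> a" "z' \<ge> a" by auto
    have par: "even (z - a) \<longleftrightarrow> even (z' - a)" using z(3) g_parity by metis
    note idx = index[OF z(1)] index[OF z(2)]
    show "z = z'"
    proof (cases "even (z - a)")
      case True
      then have "f (nat ((z - a) div 2)) = f (nat ((z' - a) div 2))"
        using z(3) par by (simp add: g_def)
      then have "nat ((z - a) div 2) = nat ((z' - a) div 2)"
        using f(1) idx by (auto simp: bij_betw_def inj_on_eq_iff)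
      then show ?thesis using z_even ge True par by metis
    next
      case False
      then have "f' (nat ((z - a) div 2)) = f' (nat ((z' - a) div 2))"
        using z(3) par by (simp add: g_def)
      then have "nat ((z - a) div 2) = nat ((z' - a) div 2)"
        using f'(1) idx by (auto simp: bij_betw_def inj_on_eq_iff)
      then show ?thesis using z_odd ge False par by metis
    qed
  qed
  moreover from this have "g ` {a..<a + int (2 * m)} = {b..<b + int (2 * m)}"
    using sub by (intro card_subset_eq) (auto simp: card_image)
  ultimately have "bij_betw g {a..<a + int (2 * m)} {b..<b + int (2 * m)}"
    by (simp add: bij_betw_def)
  moreover have "coprime z (g z)" if z: "z \<in> {a..<a + int (2 * m)}" for z
  proof (cases "even (z - a)")
    case True
    then have "coprime (a + 2 * int (nat ((z - a) div 2))) (g z)"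
      using f(2)[OF index[OF z]] by (simp only: g_def if_True)
    then show ?thesis using z_even[OF _ True] z by simp
  next
    case False
    then have "coprime (a + 1 + 2 * int (nat ((z - a) div 2))) (g z)"
      using f'(2)[OF index[OF z]] by (simp only: g_def if_False)
    then show ?thesis using z_odd[OF _ False] z by simp
  qed
  ultimately show ?thesis unfolding coprime_mapping_def by blast
qed

section \<open>Choice of the parameters\<close>

text \<open>With K about log 2 n, K + 1 is at most (ln n)^2 = exp (2 w), and r is about 20 w. So (K
  + 1) ^ (r + 1) is at most exp (42 w^2), and the exponent 43 absorbs the constant factor.\<close>

lemma coprime_threshold_log:
  fixes n :: nat
  defines "w \<equiv> ln (ln (real n))"
  assumes n: "n \<ge> 2" and w: "w \<ge> 4" and log: "log 2 (real n) + 2 \<le> (ln (real n))\<^sup>2"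
    and e6: "100 * exp (6 * w) \<le> exp (10 * w)"
    and e42: "2 * 10 ^ 8 * exp (42 * w\<^sup>2) + 1 \<le> exp (43 * w\<^sup>2)"
  shows "coprime_threshold n (nat \<lfloor>exp (43 * w\<^sup>2)\<rfloor>)"
proof -
  define K where "K = nat \<lceil>log 2 (real n)\<rceil>"
  \<comment> \<open>Odd, as the sieve requires, and large enough for 2 ^ r \<ge> exp (r / 2) \<ge>
    exp (10 w), which exceeds 100 * (K + 1) ^ 3.\<close>
  define r where "r = 2 * nat \<lceil>10 * w\<rceil> + 1"
  have log1: "log 2 (real n) \<ge> 1" using n by simp
  then have K_real: "log 2 (real n) \<le> real K" "real K \<le> log 2 (real n) + 1" "K \<ge> 1"
    unfolding K_def by linarith+
  have "real n = 2 powr log 2 (real n)" using n by simp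
  also have "\<dots> \<le> 2 powr real K" using K_real by simp
  also have "\<dots> = real (2 ^ K)" by (simp add: powr_realpow)
  finally have nK: "n \<le> 2 ^ K" by (simp only: of_nat_le_iff)
  have "0 < ln (real n)"
  proof (rule ccontr)
    assume "\<not> ?thesis"
    \<comment> \<open>Then w would be 0, because \<open>ln 0 = 0\<close> by convention, against w
      \<ge> 4.\<close>
    then have "ln (real n) = 0" using n by simp
    then show False using w by (simp add: w_def)
  qed
  then have "exp (2 * w) = (ln (real n))\<^sup>2"
    by (simp add: w_def exp_double)
  then have K1: "real K + 1 \<le> exp (2 * w)" using K_real log by simp
  have r_real: "20 * w + 1 \<le> real r" "real r \<le> 20 * w + 3" using w unfolding r_def by linarith+
  have "real (100 * (K + 1) ^ 3) = 100 * (real K + 1) ^ 3" by (simp add: add.commute)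
  also have "\<dots> \<le> 100 * exp (2 * w) ^ 3" using K1 by (intro mult_left_mono power_mono) auto
  also have "\<dots> = 100 * exp (6 * w)" by (simp add: exp_of_nat_mult[symmetric])
  also have "\<dots> \<le> exp (10 * w)" by (rule e6)
  also have "\<dots> \<le> exp (real r * (1 / 2))" using r_real by simp
  also have "\<dots> = exp (1 / 2) ^ r" by (rule exp_of_nat_mult)
  also have "\<dots> \<le> 2 ^ r"
  proof (rule power_mono)
    have "(exp (1 / 2 :: real))\<^sup>2 \<le> 2\<^sup>2" using exp_le by (simp add: exp_double[symmetric])
    then show "exp (1 / 2 :: real) \<le> 2" by (rule power2_le_imp_le) simp
  qed simp
  also have "(2 :: real) ^ r = real (2 ^ r)" by simp
  finally have r100: "100 * (K + 1) ^ 3 \<le> 2 ^ r" by (simp only: of_nat_le_iff)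
  have "real (10 ^ 8 * (K + 1) ^ (r + 1)) = 10 ^ 8 * (real K + 1) ^ (r + 1)"
    by (simp add: algebra_simps)
  also have "\<dots> \<le> 10 ^ 8 * exp (2 * w) ^ (r + 1)"
    using K1 by (intro mult_left_mono power_mono) auto
  also have "exp (2 * w) ^ (r + 1) = exp (real (r + 1) * (2 * w))" by (rule exp_of_nat_mult[symmetric])
  also have "\<dots> \<le> exp (42 * w\<^sup>2)"
  proof -
    \<comment> \<open>Here r + 1 \<le> 20 w + 4 \<le> 21 w, by w \<ge> 4.\<close>
    have "real (r + 1) * (2 * w) \<le> (21 * w) * (2 * w)"
      using r_real w by (intro mult_right_mono) auto
    then show ?thesis by (simp add: power2_eq_square)
  qed
  finally have size: "real (10 ^ 8 * (K + 1) ^ (r + 1)) \<le> 10 ^ 8 * exp (42 * w\<^sup>2)" by simp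
  show ?thesis unfolding coprime_threshold_def
  proof (intro allI impI)
    fix m A B
    assume m: "nat \<lfloor>exp (43 * w\<^sup>2)\<rfloor> \<le> 2 * m"
      and AB: "A \<subseteq> {1..int n}" "B \<subseteq> {1..int n}" "consecutive_ints (2 * m) A" "consecutive_ints (2 * m) B"
    obtain a b where ab: "A = {a..<a + int (2 * m)}" "B = {b..<b + int (2 * m)}"
      using AB(3,4) unfolding consecutive_ints_def by blast
    \<comment> \<open>Rounding down costs less than 1; this and the factor 2 of 2 m account for the
      form of \<open>e42\<close>.\<close>
    have "exp (43 * w\<^sup>2) \<le> 2 * real m + 1" using m by linarith
    then have "real (10 ^ 8 * (K + 1) ^ (r + 1)) \<le> real m" using size e42 by linarith
    then have "10 ^ 8 * (K + 1) ^ (r + 1) \<le> m" by (simp only: of_nat_le_iff)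
    moreover have "int n \<le> 2 ^ K" using nK by (metis of_nat_le_iff of_nat_numeral of_nat_power)
    then have "{1..int n} \<subseteq> {1..2 ^ K}" by simp
    then have "A \<subseteq> {1..2 ^ K}" "B \<subseteq> {1..2 ^ K}" using AB(1,2) by blast+
    moreover have "odd r" by (simp add: r_def)
    ultimately show "\<exists>g. coprime_mapping g A B"
      unfolding ab using K_real(3) r100 by (intro coprime_mapping_intervals)
  qed
qed

theorem theorem1p5:
  "\<exists>C::real. \<forall>\<^sub>F n in sequentially. real (min_threshold n) \<le> exp (C * (ln (ln (real n)))\<^sup>2)"
proof (rule exI[of _ 43])
  have "\<forall>\<^sub>F n in sequentially. ln (ln (real n)) \<ge> 4" by real_asymp
  moreover have "\<forall>\<^sub>F n in sequentially. log 2 (real n) + 2 \<le> (ln (real n))\<^sup>2" by real_asymp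
  moreover have "\<forall>\<^sub>F n in sequentially. 100 * exp (6 * ln (ln (real n))) \<le> exp (10 * ln (ln (real n)))"
    by real_asymp
  moreover have "\<forall>\<^sub>F n in sequentially.
      2 * 10 ^ 8 * exp (42 * (ln (ln (real n)))\<^sup>2) + 1 \<le> exp (43 * (ln (ln (real n)))\<^sup>2)"
    by real_asymp
  ultimately show "\<forall>\<^sub>F n in sequentially. real (min_threshold n) \<le> exp (43 * (ln (ln (real n)))\<^sup>2)"
    using eventually_ge_at_top[of 2]
  proof eventually_elim
    case (elim n)
    then have "min_threshold n \<le> nat \<lfloor>exp (43 * (ln (ln (real n)))\<^sup>2)\<rfloor>"
      unfolding min_threshold_def by (intro Least_le coprime_threshold_log)
    moreover have "(0::real) < exp (43 * (ln (ln (real n)))\<^sup>2)" by simp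
    ultimately show ?case by linarith
  qed
qed

end
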